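(* The logic $\mathcal{LB}_\supset$ is algebraizable with respect to the variety $\mathsf{ImpBiLat}$ of implicative bilattices, with equivalence formula $\varphi\leftrightarrow\psi$ and defining equation $\varphi\approx\varphi\supset\varphi$.
   Context: A bilattice is an algebra $\langle B,\land,\lor,\otimes,\oplus,\neg\rangle$ such that $\langle B,\land,\lor\rangle$ and $\langle B,\otimes,\oplus\rangle$ are lattices (not necessarily bounded) with orders $\leq_t$ and $\leq_k$, and $\neg$ is unary with: $a\leq_t b\Rightarrow\neg b\leq_t\neg a$; $a\leq_k b\Rightarrow\neg a\leq_k\neg b$; $\neg\neg a=a$. An implicative bilattice is an algebra $\langle B,\land,\lor,\otimes,\oplus,\supset,\neg\rangle$ whose $\supset$-free reduct is a bilattice and which satisfies: (IB1) $(x\supset x)\supset y\approx y$; (IB2) $x\supset(y\supset z)\approx(x\land y)\supset z\approx(x\otimes y)\supset z$; (IB3) $((x\supset y)\supset x)\supset x\approx x\supset x$; (IB4) $(x\lor y)\supset z\approx(x\supset z)\land(y\supset z)\approx(x\oplus y)\supset z$; (IB5) $x\land((x\supset y)\supset(x\otimes y))\approx x$; (IB6) $\neg(x\supset y)\supset z\approx(x\land\neg y)\supset z$. $\mathbf{Fm}$ is the formula algebra over a countable set of variables in the language $\{\land,\lor,\otimes,\oplus,\supset,\neg\}$. A prime bifilter of a bilattice $\mathbf B$ is a proper non-empty $F\subsetneq B$ that is a prime lattice filter with respect to both $\leq_t$ and $\leq_k$. If $\mathbf B$ has a $\leq_t$-maximum $\mathsf t$ and $F$ is a prime bifilter, let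 $\mathbf B_\supset$ be $\mathbf B$ expanded by $a\supset b=b$ if $a\in F$ and $a\supset b=\mathsf t$ if $a\notin F$. $\mathcal{LB}_\supset$ is the logic given by: $\Gamma\models_{\mathcal{LB}_\supset}\varphi$ iff for all such $\langle\mathbf B_\supset,F\rangle$ and all homomorphisms $v:\mathbf{Fm}\to\mathbf B_\supset$, $v[\Gamma]\subseteq F$ implies $v(\varphi)\in F$. Known facts (Arieli–Avron), which may be used as equivalent definitions of $\mathcal{LB}_\supset$: (a) $\models_{\mathcal{LB}_\supset}$ coincides with the consequence of the single matrix $\langle\mathcal{FOUR}_\supset,\{\top,\mathsf t\}\rangle$, where $\mathcal{FOUR}$ is the bilattice on $\{\mathsf f,\bot,\top,\mathsf t\}$ with $\mathsf f<_t\bot,\top<_t\mathsf t$, $\bot<_k\mathsf f,\mathsf t<_k\top$, $\neg\mathsf f=\mathsf t$, $\neg\mathsf t=\mathsf f$, $\neg\bot=\bot$, $\neg\top=\top$, and $\mathcal{FOUR}_\supset$ is its expansion by the operation $a\supset b=b$ if $a\in\{\top,\mathsf t\}$ and $a\supset b=\mathsf t$ if $a\in\{\mathsf f,\bot\}$; (b) it coincides with the consequence relation of the Hilbert calculus with modus ponens (from $p$, $p\supset q$ infer $q$) as only rule and axioms: $p\supset(q\supset p)$; $(p\supset(q\supset r))\supset((p\supset q)\supset(p\supset r))$; $((p\supset q)\supset p)\supset p$; $(p\land q)\supset p$; $(p\land q)\supset q$; $p\supset(q\supset(p\land q))$; $(p\otimes q)\supset p$; $(p\otimes q)\supset q$;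 $p\supset(q\supset(p\otimes q))$; $p\supset(p\lor q)$; $q\supset(p\lor q)$; $(p\supset r)\supset((q\supset r)\supset((p\lor q)\supset r))$; $p\supset(p\oplus q)$; $q\supset(p\oplus q)$; $(p\supset r)\supset((q\supset r)\supset((p\oplus q)\supset r))$; $\neg(p\land q)\equiv(\neg p\lor\neg q)$; $\neg(p\lor q)\equiv(\neg p\land\neg q)$; $\neg(p\otimes q)\equiv(\neg p\otimes\neg q)$; $\neg(p\oplus q)\equiv(\neg p\oplus\neg q)$; $\neg(p\supset q)\equiv(p\land\neg q)$; $p\equiv\neg\neg p$; where $\varphi\equiv\psi$ abbreviates $(\varphi\supset\psi)\land(\psi\supset\varphi)$. Abbreviations: $p\to q:=(p\supset q)\land(\neg q\supset\neg p)$; $p\leftrightarrow q:=(p\to q)\land(q\to p)$. Algebraizability (Blok–Pigozzi) of a logic $\vdash$ with respect to a variety $\mathsf K$ with equivalence formula $\varphi\leftrightarrow\psi$ and defining equation $\varphi\approx\varphi\supset\varphi$ means: (1) for all $\Gamma\cup\{\varphi\}\subseteq Fm$, $\Gamma\vdash\varphi$ iff $\{\gamma\approx\gamma\supset\gamma:\gamma\in\Gamma\}\models_{\mathsf K}\varphi\approx\varphi\supset\varphi$; and (2) for all formulas $\varphi,\psi$, the equation $\varphi\approx\psi$ and the equation $(\varphi\leftrightarrow\psi)\approx(\varphi\leftrightarrow\psi)\supset(\varphi\leftrightarrow\psi)$ are interderivable in the equational consequence $\models_{\mathsf K}$. *)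

theory Defs
  imports "HOL-Algebra.Congruence"
begin

section \<open>Bilattices and implicative bilattices\<close>

record 'a bilat = "'a partial_object" +
  tmeet :: "'a \<Rightarrow> 'a \<Rightarrow> 'a" (infixl "\<curlywedge>\<index>" 70)
  tjoin :: "'a \<Rightarrow> 'a \<Rightarrow> 'a" (infixl "\<curlyvee>\<index>" 65)
  kmeet :: "'a \<Rightarrow> 'a \<Rightarrow> 'a" (infixl "\<otimes>\<index>" 70)
  kjoin :: "'a \<Rightarrow> 'a \<Rightarrow> 'a" (infixl "\<oplus>\<index>" 65)
  neg :: "'a \<Rightarrow> 'a" ("\<sim>\<index> _" [81] 80)

record 'a impbilat = "'a bilat" +
  imp :: "'a \<Rightarrow> 'a \<Rightarrow> 'a" (infixr "\<sqsupset>\<index>" 60)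

locale lattice_on =
  fixes A :: "'a set" and m j :: "'a \<Rightarrow> 'a \<Rightarrow> 'a"
  assumes meet_closed: "\<lbrakk>x \<in> A; y \<in> A\<rbrakk> \<Longrightarrow> m x y \<in> A"
    and join_closed: "\<lbrakk>x \<in> A; y \<in> A\<rbrakk> \<Longrightarrow> j x y \<in> A"
    and meet_assoc: "\<lbrakk>x \<in> A; y \<in> A; z \<in> A\<rbrakk> \<Longrightarrow> m (m x y) z = m x (m y z)"
    and join_assoc: "\<lbrakk>x \<in> A; y \<in> A; z \<in> A\<rbrakk> \<Longrightarrow> j (j x y) z = j x (j y z)"
    and meet_comm: "\<lbrakk>x \<in> A; y \<in> A\<rbrakk> \<Longrightarrow> m x y = m y x"
    and join_comm: "\<lbrakk>x \<in> A; y \<in> A\<rbrakk> \<Longrightarrow> j x y = j y x"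
    and meet_absorb: "\<lbrakk>x \<in> A; y \<in> A\<rbrakk> \<Longrightarrow> m x (j x y) = x"
    and join_absorb: "\<lbrakk>x \<in> A; y \<in> A\<rbrakk> \<Longrightarrow> j x (m x y) = x"

definition meet_le :: "('a \<Rightarrow> 'a \<Rightarrow> 'a) \<Rightarrow> 'a \<Rightarrow> 'a \<Rightarrow> bool"
  where "meet_le m a b \<longleftrightarrow> m a b = a"

abbreviation le_t :: "('a, 'm) bilat_scheme \<Rightarrow> 'a \<Rightarrow> 'a \<Rightarrow> bool"
  where "le_t B \<equiv> meet_le (tmeet B)"

abbreviation le_k :: "('a, 'm) bilat_scheme \<Rightarrow> 'a \<Rightarrow> 'a \<Rightarrow> bool"
  where "le_k B \<equiv> meet_le (kmeet B)"

locale bilattice =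
  fixes B :: "('a, 'm) bilat_scheme" (structure)
  assumes nonempty: "carrier B \<noteq> {}"
    and lattice_t: "lattice_on (carrier B) (tmeet B) (tjoin B)"
    and lattice_k: "lattice_on (carrier B) (kmeet B) (kjoin B)"
    and neg_closed: "a \<in> carrier B \<Longrightarrow> \<sim> a \<in> carrier B"
    and neg_antimono_t:
      "\<lbrakk>a \<in> carrier B; b \<in> carrier B; le_t B a b\<rbrakk> \<Longrightarrow> le_t B (\<sim> b) (\<sim> a)"
    and neg_mono_k:
      "\<lbrakk>a \<in> carrier B; b \<in> carrier B; le_k B a b\<rbrakk> \<Longrightarrow> le_k B (\<sim> a) (\<sim> b)"
    and neg_neg: "a \<in> carrier B \<Longrightarrow> \<sim> (\<sim> a) = a"

locale implicative_bilattice = bilattice B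
  for B :: "('a, 'm) impbilat_scheme" (structure) +
  assumes imp_closed: "\<lbrakk>x \<in> carrier B; y \<in> carrier B\<rbrakk> \<Longrightarrow> x \<sqsupset> y \<in> carrier B"
    and IB1: "\<lbrakk>x \<in> carrier B; y \<in> carrier B\<rbrakk> \<Longrightarrow> (x \<sqsupset> x) \<sqsupset> y = y"
    and IB2_t: "\<lbrakk>x \<in> carrier B; y \<in> carrier B; z \<in> carrier B\<rbrakk> \<Longrightarrow>
      x \<sqsupset> (y \<sqsupset> z) = (x \<curlywedge> y) \<sqsupset> z"
    and IB2_k: "\<lbrakk>x \<in> carrier B; y \<in> carrier B; z \<in> carrier B\<rbrakk> \<Longrightarrow>
      (x \<curlywedge> y) \<sqsupset> z = (x \<otimes> y) \<sqsupset> z"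
    and IB3: "\<lbrakk>x \<in> carrier B; y \<in> carrier B\<rbrakk> \<Longrightarrow>
      ((x \<sqsupset> y) \<sqsupset> x) \<sqsupset> x = x \<sqsupset> x"
    and IB4_t: "\<lbrakk>x \<in> carrier B; y \<in> carrier B; z \<in> carrier B\<rbrakk> \<Longrightarrow>
      (x \<curlyvee> y) \<sqsupset> z = (x \<sqsupset> z) \<curlywedge> (y \<sqsupset> z)"
    and IB4_k: "\<lbrakk>x \<in> carrier B; y \<in> carrier B; z \<in> carrier B\<rbrakk> \<Longrightarrow>
      (x \<sqsupset> z) \<curlywedge> (y \<sqsupset> z) = (x \<oplus> y) \<sqsupset> z"
    and IB5: "\<lbrakk>x \<in> carrier B; y \<in> carrier B\<rbrakk> \<Longrightarrow>
      x \<curlywedge> ((x \<sqsupset> y) \<sqsupset> (x \<otimes> y)) = x"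
    and IB6: "\<lbrakk>x \<in> carrier B; y \<in> carrier B; z \<in> carrier B\<rbrakk> \<Longrightarrow>
      \<sim> (x \<sqsupset> y) \<sqsupset> z = (x \<curlywedge> \<sim> y) \<sqsupset> z"

definition ImpBiLat :: "'a impbilat set"
  where "ImpBiLat = {B. implicative_bilattice B}"


section \<open>The formula algebra\<close>

datatype fm =
    Var nat
  | And fm fm (infixl "\<^bold>\<and>" 70)
  | Or fm fm (infixl "\<^bold>\<or>" 65)
  | Otimes fm fm (infixl "\<^bold>\<otimes>" 70)
  | Oplus fm fm (infixl "\<^bold>\<oplus>" 65)
  | Imp fm fm (infixr "\<^bold>\<supset>" 60)
  | Neg fm ("\<^bold>\<not> _" [81] 80)

definition Fm :: "fm impbilat"
  where "Fm = \<lparr>carrier = UNIV, tmeet = And, tjoin = Or, kmeet = Otimes, kjoin = Oplus,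
    neg = Neg, imp = Imp\<rparr>"

definition alg_hom :: "'a impbilat \<Rightarrow> 'b impbilat \<Rightarrow> ('a \<Rightarrow> 'b) set"
  where "alg_hom A B = {h.
    (\<forall>x \<in> carrier A. h x \<in> carrier B) \<and>
    (\<forall>x \<in> carrier A. h (\<sim>\<^bsub>A\<^esub> x) = \<sim>\<^bsub>B\<^esub> (h x)) \<and>
    (\<forall>x \<in> carrier A. \<forall>y \<in> carrier A.
      h (x \<curlywedge>\<^bsub>A\<^esub> y) = h x \<curlywedge>\<^bsub>B\<^esub> h y \<and>
      h (x \<curlyvee>\<^bsub>A\<^esub> y) = h x \<curlyvee>\<^bsub>B\<^esub> h y \<and>
      h (x \<otimes>\<^bsub>A\<^esub> y) = h x \<otimes>\<^bsub>B\<^esub> h y \<and>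
      h (x \<oplus>\<^bsub>A\<^esub> y) = h x \<oplus>\<^bsub>B\<^esub> h y \<and>
      h (x \<sqsupset>\<^bsub>A\<^esub> y) = h x \<sqsupset>\<^bsub>B\<^esub> h y)}"

definition fm_to :: "fm \<Rightarrow> fm \<Rightarrow> fm" (infixr "\<^bold>\<rightarrow>" 60)
  where "p \<^bold>\<rightarrow> q = (p \<^bold>\<supset> q) \<^bold>\<and> (\<^bold>\<not> q \<^bold>\<supset> \<^bold>\<not> p)"

definition fm_equiv :: "fm \<Rightarrow> fm \<Rightarrow> fm" (infix "\<^bold>\<leftrightarrow>" 55)
  where "p \<^bold>\<leftrightarrow> q = (p \<^bold>\<rightarrow> q) \<^bold>\<and> (q \<^bold>\<rightarrow> p)"


section \<open>The logic\<close>

definition prime_filter_on :: "'a set \<Rightarrow> ('a \<Rightarrow> 'a \<Rightarrow> 'a) \<Rightarrow> ('a \<Rightarrow> 'a \<Rightarrow> 'a) \<Rightarrow> 'a set \<Rightarrow> bool"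
  where "prime_filter_on A m j F \<longleftrightarrow>
    F \<noteq> {} \<and> F \<subset> A \<and>
    (\<forall>x \<in> F. \<forall>y \<in> A. meet_le m x y \<longrightarrow> y \<in> F) \<and>
    (\<forall>x \<in> F. \<forall>y \<in> F. m x y \<in> F) \<and>
    (\<forall>x \<in> A. \<forall>y \<in> A. j x y \<in> F \<longrightarrow> x \<in> F \<or> y \<in> F)"

definition prime_bifilter :: "('a, 'm) bilat_scheme \<Rightarrow> 'a set \<Rightarrow> bool"
  where "prime_bifilter B F \<longleftrightarrow>
    prime_filter_on (carrier B) (tmeet B) (tjoin B) F \<and>
    prime_filter_on (carrier B) (kmeet B) (kjoin B) F"

definition is_t_max :: "('a, 'm) bilat_scheme \<Rightarrow> 'a \<Rightarrow> bool"
  where "is_t_max B t \<longleftrightarrow> t \<in> carrier B \<and> (\<forall>a \<in> carrier B. le_t B a t)"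

definition imp_expansion :: "'a bilat \<Rightarrow> 'a set \<Rightarrow> 'a \<Rightarrow> 'a impbilat"
  where "imp_expansion B F t =
    \<lparr>carrier = carrier B, tmeet = tmeet B, tjoin = tjoin B, kmeet = kmeet B, kjoin = kjoin B,
     neg = neg B, imp = (\<lambda>a b. if a \<in> F then b else t)\<rparr>"

text \<open>
  HOL cannot quantify over all types inside a formula, so the consequence relation is indexed by
  the type \<open>'b\<close> from which the carriers of the bilattices are drawn. Carriers are arbitrary subsets
  of \<open>'b\<close>; as there are countably many formulas, every counterexample restricts to a countable
  subalgebra (containing the truth maximum), so the relation is the same for all infinite \<open>'b\<close>.
  The same remark applies to \<open>eq_consequence\<close> below.
\<close>

definition LB_consequence :: "'b itself \<Rightarrow> fm set \<Rightarrow> fm \<Rightarrow> bool"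
  where "LB_consequence (_ :: 'b itself) \<Gamma> \<phi> \<longleftrightarrow>
    (\<forall>(B :: 'b bilat) F t. bilattice B \<longrightarrow> is_t_max B t \<longrightarrow> prime_bifilter B F \<longrightarrow>
      (\<forall>v \<in> alg_hom Fm (imp_expansion B F t). v ` \<Gamma> \<subseteq> F \<longrightarrow> v \<phi> \<in> F))"


section \<open>Equational consequence and algebraizability\<close>

definition satisfies :: "(fm \<Rightarrow> 'a) \<Rightarrow> fm \<times> fm \<Rightarrow> bool"
  where "satisfies v e \<longleftrightarrow> v (fst e) = v (snd e)"

definition eq_consequence :: "'a impbilat set \<Rightarrow> (fm \<times> fm) set \<Rightarrow> fm \<times> fm \<Rightarrow> bool"
  where "eq_consequence K E e \<longleftrightarrow>
    (\<forall>A \<in> K. \<forall>v \<in> alg_hom Fm A. (\<forall>d \<in> E. satisfies v d) \<longrightarrow> satisfies v e)"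

definition is_algebra :: "'a impbilat \<Rightarrow> bool"
  where "is_algebra A \<longleftrightarrow> carrier A \<noteq> {} \<and>
    (\<forall>x \<in> carrier A. \<sim>\<^bsub>A\<^esub> x \<in> carrier A) \<and>
    (\<forall>x \<in> carrier A. \<forall>y \<in> carrier A.
      x \<curlywedge>\<^bsub>A\<^esub> y \<in> carrier A \<and> x \<curlyvee>\<^bsub>A\<^esub> y \<in> carrier A \<and>
      x \<otimes>\<^bsub>A\<^esub> y \<in> carrier A \<and> x \<oplus>\<^bsub>A\<^esub> y \<in> carrier A \<and>
      x \<sqsupset>\<^bsub>A\<^esub> y \<in> carrier A)"

definition variety :: "'a impbilat set \<Rightarrow> bool"
  where "variety K \<longleftrightarrow>
    (\<exists>E. K = {A. is_algebra A \<and> (\<forall>e \<in> E. \<forall>v \<in> alg_hom Fm A. satisfies v e)})"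

text \<open>
  \<open>eqv\<close> is the equivalence formula and \<open>de\<close> the defining equation, both given as functions of
  the formulas substituted into them.
\<close>

definition algebraizable ::
  "(fm set \<Rightarrow> fm \<Rightarrow> bool) \<Rightarrow> 'a impbilat set \<Rightarrow> (fm \<Rightarrow> fm \<Rightarrow> fm) \<Rightarrow> (fm \<Rightarrow> fm \<times> fm) \<Rightarrow> bool"
  where "algebraizable L K eqv de \<longleftrightarrow>
    variety K \<and>
    (\<forall>\<Gamma> \<phi>. L \<Gamma> \<phi> \<longleftrightarrow> eq_consequence K (de ` \<Gamma>) (de \<phi>)) \<and>
    (\<forall>\<phi> \<psi>. eq_consequence K {(\<phi>, \<psi>)} (de (eqv \<phi> \<psi>)) \<and>
           eq_consequence K {de (eqv \<phi> \<psi>)} (\<phi>, \<psi>))"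

end

theory Submission imports Defs begin

text \<open>
  Both consequence relations amount to preservation of designated values under homomorphisms into
  \<open>FOUR\<^sub>\<supset>\<close>. For \<open>LB\<^sub>\<supset>\<close>, a prime bifilter \<open>F\<close> induces such a homomorphism
  \<open>a \<mapsto> (a \<in> F, \<sim> a \<in> F)\<close>. For implicative bilattices, IB1 makes
  \<open>D = {x. x = x \<sqsupset> x}\<close> the set of all \<open>e\<close> with \<open>e \<sqsupset> y = y\<close> for every \<open>y\<close>; it validates the
  Hilbert calculus, so the preimage of \<open>D\<close> under a valuation is a theory, and a theory not
  containing \<open>\<phi>\<close> extends by Zorn's lemma to a maximal one, which again is a homomorphism into
  \<open>FOUR\<^sub>\<supset>\<close>. Finally, if \<open>x \<sqsupset> y\<close> and \<open>\<sim> x \<sqsupset> \<sim> y\<close> lie in \<open>D\<close>, then \<open>x = x \<otimes> y\<close> by IB5, which gives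
  the interderivability of \<open>\<phi> \<approx> \<psi>\<close> with the equation for \<open>\<phi> \<^bold>\<leftrightarrow> \<psi>\<close>.
\<close>

section \<open>Lattices and bilattices\<close>

context lattice_on
begin

lemma dual: "lattice_on A j m"
  by unfold_locales
    (simp_all add: meet_closed join_closed meet_assoc join_assoc meet_absorb join_absorb,
      simp_all add: meet_comm join_comm)

lemma meet_idem: "x \<in> A \<Longrightarrow> m x x = x"
  by (metis join_absorb meet_absorb meet_closed)

lemma meet_le_antisym:
  "\<lbrakk>x \<in> A; y \<in> A; meet_le m x y; meet_le m y x\<rbrakk> \<Longrightarrow> x = y"
  by (metis meet_le_def meet_comm)

lemma meet_le_join_iff: "\<lbrakk>x \<in> A; y \<in> A\<rbrakk> \<Longrightarrow> meet_le j x y \<longleftrightarrow> meet_le m y x"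
  by (metis meet_le_def meet_comm join_comm meet_absorb join_absorb)

lemma meet_le_left: "\<lbrakk>x \<in> A; y \<in> A\<rbrakk> \<Longrightarrow> meet_le m (m x y) x"
  by (metis meet_le_def meet_comm meet_assoc meet_idem)

lemma meet_le_right: "\<lbrakk>x \<in> A; y \<in> A\<rbrakk> \<Longrightarrow> meet_le m (m x y) y"
  by (metis meet_le_left meet_comm)

lemma join_ge_left: "\<lbrakk>x \<in> A; y \<in> A\<rbrakk> \<Longrightarrow> meet_le m x (j x y)"
  by (simp add: meet_le_def meet_absorb)

lemma join_ge_right: "\<lbrakk>x \<in> A; y \<in> A\<rbrakk> \<Longrightarrow> meet_le m y (j x y)"
  by (metis join_ge_left join_comm)

lemma meet_le_meet:
  "\<lbrakk>x \<in> A; y \<in> A; z \<in> A; meet_le m z x; meet_le m z y\<rbrakk> \<Longrightarrow> meet_le m z (m x y)"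
  by (metis meet_le_def meet_assoc)

lemma prime_filter_meet_iff:
  assumes F: "prime_filter_on A m j F" and x: "x \<in> A" and y: "y \<in> A"
  shows "m x y \<in> F \<longleftrightarrow> x \<in> F \<and> y \<in> F"
proof
  assume "m x y \<in> F"
  then show "x \<in> F \<and> y \<in> F"
    using F x y meet_le_left[OF x y] meet_le_right[OF x y] by (simp add: prime_filter_on_def)
next
  assume "x \<in> F \<and> y \<in> F"
  then show "m x y \<in> F" using F by (simp add: prime_filter_on_def)
qed

lemma prime_filter_join_iff:
  assumes F: "prime_filter_on A m j F" and x: "x \<in> A" and y: "y \<in> A"
  shows "j x y \<in> F \<longleftrightarrow> x \<in> F \<or> y \<in> F"
proof
  assume "j x y \<in> F"
  then show "x \<in> F \<or> y \<in> F" using F x y by (simp add: prime_filter_on_def)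
next
  have up: "\<lbrakk>z \<in> F; w \<in> A; meet_le m z w\<rbrakk> \<Longrightarrow> w \<in> F" for z w
    using F by (simp add: prime_filter_on_def)
  assume "x \<in> F \<or> y \<in> F"
  then show "j x y \<in> F"
    using up join_closed[OF x y] join_ge_left[OF x y] join_ge_right[OF x y] by blast
qed

end

text \<open>An involution monotone in both directions between two orders is an order isomorphism, so
  it carries meets to meets. Two lattice structures on one carrier are allowed because negation maps
  the truth lattice to its dual and the knowledge lattice to itself.\<close>

lemma involution_preserves_meet:
  assumes "lattice_on A m j" "lattice_on A m' j'"
    and closed: "\<And>x. x \<in> A \<Longrightarrow> n x \<in> A"
    and invol: "\<And>x. x \<in> A \<Longrightarrow> n (n x) = x"
    and mono: "\<And>x y. \<lbrakk>x \<in> A; y \<in> A; meet_le m x y\<rbrakk> \<Longrightarrow> meet_le m' (n x) (n y)"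
    and mono': "\<And>x y. \<lbrakk>x \<in> A; y \<in> A; meet_le m' x y\<rbrakk> \<Longrightarrow> meet_le m (n x) (n y)"
    and x: "x \<in> A" and y: "y \<in> A"
  shows "n (m x y) = m' (n x) (n y)"
proof -
  interpret L: lattice_on A m j by fact
  interpret L': lattice_on A m' j' by fact
  let ?c = "m' (n x) (n y)"
  have c: "?c \<in> A" using x y closed L'.meet_closed by blast
  have xy: "m x y \<in> A" using x y L.meet_closed by blast
  have 1: "meet_le m' (n (m x y)) ?c"
    by (intro L'.meet_le_meet mono L.meet_le_left L.meet_le_right closed x y xy)
  \<comment> \<open>As \<open>n\<close> is its own inverse, \<open>n ?c\<close> is a lower bound of
    \<open>x\<close> and \<open>y\<close>; applying \<open>n\<close> once more yields the reverse
    inequality.\<close>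
  have "meet_le m (n ?c) (n (n x))" "meet_le m (n ?c) (n (n y))"
    by (intro mono' L'.meet_le_left L'.meet_le_right closed c x y)+
  then have "meet_le m (n ?c) (m x y)"
    using x y c closed invol L.meet_le_meet by simp
  then have "meet_le m' (n (n ?c)) (n (m x y))"
    using mono c xy closed by blast
  then have "meet_le m' ?c (n (m x y))"
    using invol[OF c] by simp
  with 1 show ?thesis
    using L'.meet_le_antisym c closed xy by blast
qed

section \<open>De Morgan laws for negation\<close>

context bilattice
begin

sublocale t: lattice_on "carrier B" "tmeet B" "tjoin B" by (rule lattice_t)
sublocale k: lattice_on "carrier B" "kmeet B" "kjoin B" by (rule lattice_k)

lemma neg_tmeet:
  assumes "x \<in> carrier B" "y \<in> carrier B"
  shows "\<sim> (x \<curlywedge> y) = \<sim> x \<curlyvee> \<sim> y"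
  by (rule involution_preserves_meet[OF t.lattice_on_axioms t.dual])
    (simp_all add: assms neg_closed neg_neg t.meet_le_join_iff neg_antimono_t)

lemma neg_tjoin:
  assumes "x \<in> carrier B" "y \<in> carrier B"
  shows "\<sim> (x \<curlyvee> y) = \<sim> x \<curlywedge> \<sim> y"
  by (rule involution_preserves_meet[OF t.dual t.lattice_on_axioms])
    (simp_all add: assms neg_closed neg_neg t.meet_le_join_iff neg_antimono_t)

lemma neg_kmeet:
  assumes "x \<in> carrier B" "y \<in> carrier B"
  shows "\<sim> (x \<otimes> y) = \<sim> x \<otimes> \<sim> y"
  by (rule involution_preserves_meet[OF k.lattice_on_axioms k.lattice_on_axioms])
    (simp_all add: assms neg_closed neg_neg neg_mono_k)

lemma neg_kjoin:
  assumes "x \<in> carrier B" "y \<in> carrier B"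
  shows "\<sim> (x \<oplus> y) = \<sim> x \<oplus> \<sim> y"
  by (rule involution_preserves_meet[OF k.dual k.dual])
    (simp_all add: assms neg_closed neg_neg k.meet_le_join_iff neg_mono_k)

end

section \<open>The designated elements of an implicative bilattice\<close>

definition designated :: "('a, 'm) impbilat_scheme \<Rightarrow> 'a set"
  where "designated B = {x \<in> carrier B. x = imp B x x}"

context implicative_bilattice
begin

lemmas closed =
  t.meet_closed t.join_closed k.meet_closed k.join_closed neg_closed imp_closed

lemma designatedD: "e \<in> designated B \<Longrightarrow> e \<in> carrier B"
  by (simp add: designated_def)

lemma designated_imp: "\<lbrakk>e \<in> designated B; y \<in> carrier B\<rbrakk> \<Longrightarrow> e \<sqsupset> y = y"
  unfolding designated_def using IB1 by (metis (mono_tags, lifting) mem_Collect_eq)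

lemma designatedI: "\<lbrakk>e \<in> carrier B; \<And>y. y \<in> carrier B \<Longrightarrow> e \<sqsupset> y = y\<rbrakk> \<Longrightarrow> e \<in> designated B"
  by (simp add: designated_def)

lemma imp_self: "x \<in> carrier B \<Longrightarrow> x \<sqsupset> x \<in> designated B"
  by (simp add: designatedI imp_closed IB1)

text \<open>Since \<open>e \<curlywedge> a = e\<close>, IB2 equates
  \<open>e \<sqsupset> (a \<sqsupset> z)\<close> with \<open>e \<sqsupset> z\<close>, and the left
  identity \<open>e\<close> cancels.\<close>

lemma designated_up_t:
  assumes e: "e \<in> designated B" and a: "a \<in> carrier B" and le: "le_t B e a"
  shows "a \<in> designated B"
proof (rule designatedI[OF a])
  fix z assume z: "z \<in> carrier B"
  have "e \<sqsupset> (a \<sqsupset> z) = e \<sqsupset> z"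
    using IB2_t[OF designatedD[OF e] a z] le by (simp add: meet_le_def)
  then show "a \<sqsupset> z = z" using designated_imp[OF e] z a imp_closed by simp
qed

text \<open>If \<open>a\<close> is below \<open>b\<close>, then \<open>a \<curlyvee> b = b\<close>,
  and IB4 exhibits \<open>b \<sqsupset> z\<close> as a meet with \<open>a \<sqsupset> z\<close> as
  one factor.\<close>

lemma imp_antimono_t:
  assumes "a \<in> carrier B" "b \<in> carrier B" "z \<in> carrier B" "le_t B a b"
  shows "le_t B (b \<sqsupset> z) (a \<sqsupset> z)"
proof -
  have "a \<curlyvee> b = b"
    using assms by (metis meet_le_def t.join_absorb t.join_comm t.meet_comm)
  then show ?thesis using IB4_t[of a b z] assms
    by (metis imp_closed t.meet_le_left)
qed

section \<open>The positive Hilbert axioms inside an implicative bilattice\<close>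

lemma imp_exchange:
  assumes "x \<in> carrier B" "y \<in> carrier B" "z \<in> carrier B"
  shows "x \<sqsupset> (y \<sqsupset> z) = y \<sqsupset> (x \<sqsupset> z)"
  using assms by (simp add: IB2_t t.meet_comm)

text \<open>Antitonicity puts \<open>e \<sqsupset> e = e\<close> below
  \<open>(y \<curlywedge> e) \<sqsupset> e\<close>, which IB2 curries to
  \<open>y \<sqsupset> (e \<sqsupset> e) = y \<sqsupset> e\<close>.\<close>

lemma imp_designated:
  assumes e: "e \<in> designated B" and y: "y \<in> carrier B"
  shows "y \<sqsupset> e \<in> designated B"
proof -
  have E: "e \<in> carrier B" using e designatedD by blast
  have "le_t B (e \<sqsupset> e) ((y \<curlywedge> e) \<sqsupset> e)"
    by (rule imp_antimono_t) (simp_all add: E y closed t.meet_le_right)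
  moreover have "(y \<curlywedge> e) \<sqsupset> e = y \<sqsupset> (e \<sqsupset> e)"
    using IB2_t y E by simp
  ultimately show ?thesis
    using designated_up_t[OF e, of "y \<sqsupset> e"] designated_imp[OF e] by (simp add: E y closed)
qed

lemma imp_tmeetI:
  assumes "x \<in> carrier B" "y \<in> carrier B"
  shows "x \<sqsupset> (y \<sqsupset> (x \<curlywedge> y)) \<in> designated B"
  using assms by (simp add: IB2_t imp_self closed)

lemma imp_kmeetI:
  assumes "x \<in> carrier B" "y \<in> carrier B"
  shows "x \<sqsupset> (y \<sqsupset> (x \<otimes> y)) \<in> designated B"
  using assms by (simp add: IB2_t IB2_k imp_self closed)

lemma imp_K:
  assumes "x \<in> carrier B" "y \<in> carrier B"
  shows "x \<sqsupset> (y \<sqsupset> x) \<in> designated B"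
  using assms imp_exchange[of x y x] by (simp add: imp_designated imp_self)

lemma imp_tmeet1:
  assumes "x \<in> carrier B" "y \<in> carrier B"
  shows "(x \<curlywedge> y) \<sqsupset> x \<in> designated B"
  using assms imp_K[of x y] by (simp add: IB2_t)

lemma imp_tmeet2:
  assumes "x \<in> carrier B" "y \<in> carrier B"
  shows "(x \<curlywedge> y) \<sqsupset> y \<in> designated B"
  using assms imp_tmeet1[of y x] by (simp add: t.meet_comm)

lemma le_t_imp:
  assumes "x \<in> carrier B" "y \<in> carrier B" "le_t B x y"
  shows "x \<sqsupset> y \<in> designated B"
  using assms imp_tmeet2[of x y] by (simp add: meet_le_def)

text \<open>IB2 makes the two meets interchangeable as antecedents, so the argument for the truth
  order carries over.\<close>

lemma le_k_imp:
  assumes "x \<in> carrier B" "y \<in> carrier B" "le_k B x y"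
  shows "x \<sqsupset> y \<in> designated B"
  using assms imp_tmeet2[of x y] by (simp add: IB2_k meet_le_def)

text \<open>In IB5 the designated antecedent \<open>x \<sqsupset> y\<close> drops out, leaving
  \<open>x \<curlywedge> (x \<otimes> y) = x\<close>. This turns a designated implication into an
  inequality.\<close>

lemma imp_le_kmeet:
  assumes "x \<in> carrier B" "y \<in> carrier B" "x \<sqsupset> y \<in> designated B"
  shows "le_t B x (x \<otimes> y)"
  using IB5[of x y] designated_imp[of "x \<sqsupset> y" "x \<otimes> y"] assms k.meet_closed
  by (simp add: meet_le_def)

text \<open>From \<open>x\<close> below \<open>x \<otimes> y\<close>, antitonicity puts
  \<open>(x \<otimes> y) \<sqsupset> z\<close>, that is
  \<open>x \<sqsupset> (y \<sqsupset> z)\<close>, below \<open>x \<sqsupset> z\<close>. The former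
  is designated because \<open>y \<sqsupset> z\<close> is.\<close>

lemma imp_trans:
  assumes x: "x \<in> carrier B" and y: "y \<in> carrier B" and z: "z \<in> carrier B"
    and xy: "x \<sqsupset> y \<in> designated B" and yz: "y \<sqsupset> z \<in> designated B"
  shows "x \<sqsupset> z \<in> designated B"
proof -
  have "le_t B ((x \<otimes> y) \<sqsupset> z) (x \<sqsupset> z)"
    by (rule imp_antimono_t[OF x _ z imp_le_kmeet[OF x y xy]]) (simp add: closed x y)
  moreover have "(x \<otimes> y) \<sqsupset> z = x \<sqsupset> (y \<sqsupset> z)"
    using IB2_t IB2_k x y z by simp
  ultimately show ?thesis
    using designated_up_t[OF imp_designated[OF yz x], of "x \<sqsupset> z"] by (simp add: closed x z)
qed

text \<open>Transitivity is applied once through \<open>y\<close> and, after an exchange, once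
  through \<open>z\<close>. The antecedent \<open>x\<close> then occurs twice and is contracted by
  IB2 and idempotence.\<close>

lemma imp_tmeet:
  assumes x: "x \<in> carrier B" and y: "y \<in> carrier B" and z: "z \<in> carrier B"
    and xy: "x \<sqsupset> y \<in> designated B" and xz: "x \<sqsupset> z \<in> designated B"
  shows "x \<sqsupset> (y \<curlywedge> z) \<in> designated B"
proof -
  have "x \<sqsupset> (z \<sqsupset> (y \<curlywedge> z)) \<in> designated B"
    by (rule imp_trans[OF x y _ xy imp_tmeetI[OF y z]]) (simp add: closed y z)
  then have "z \<sqsupset> (x \<sqsupset> (y \<curlywedge> z)) \<in> designated B"
    using imp_exchange[of x z "y \<curlywedge> z"] by (simp add: closed x y z)
  then have "x \<sqsupset> (x \<sqsupset> (y \<curlywedge> z)) \<in> designated B"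
    using imp_trans[OF x z _ xz, of "x \<sqsupset> (y \<curlywedge> z)"] by (simp add: closed x y z)
  then show ?thesis
    using IB2_t[of x x "y \<curlywedge> z"] x y z by (simp add: closed t.meet_idem)
qed

lemma imp_mp:
  assumes "x \<in> carrier B" "y \<in> carrier B"
  shows "((x \<sqsupset> y) \<curlywedge> x) \<sqsupset> y \<in> designated B"
  using assms imp_self[of "x \<sqsupset> y"] by (simp add: IB2_t[symmetric] closed)

text \<open>By IB2 the axiom curries to \<open>?c \<sqsupset> z\<close>, where \<open>?c\<close> is
  the meet of its three antecedents; \<open>z\<close> follows from \<open>?c\<close> by three uses
  of modus ponens.\<close>

lemma imp_S:
  assumes x: "x \<in> carrier B" and y: "y \<in> carrier B" and z: "z \<in> carrier B"
  shows "(x \<sqsupset> (y \<sqsupset> z)) \<sqsupset> ((x \<sqsupset> y) \<sqsupset> (x \<sqsupset> z)) \<in> designated B"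
proof -
  let ?a = "x \<sqsupset> (y \<sqsupset> z)" and ?b = "x \<sqsupset> y"
  let ?c = "(?a \<curlywedge> ?b) \<curlywedge> x"
  note cl = closed x y z
  have ab: "?c \<sqsupset> (?a \<curlywedge> ?b) \<in> designated B" and cx: "?c \<sqsupset> x \<in> designated B"
    by (rule imp_tmeet1 imp_tmeet2; simp add: cl)+
  have ca: "?c \<sqsupset> ?a \<in> designated B"
    by (rule imp_trans[OF _ _ _ ab imp_tmeet1]) (simp_all add: cl)
  have cb: "?c \<sqsupset> ?b \<in> designated B"
    by (rule imp_trans[OF _ _ _ ab imp_tmeet2]) (simp_all add: cl)
  have cy: "?c \<sqsupset> y \<in> designated B"
    by (rule imp_trans[OF _ _ _ imp_tmeet[OF _ _ _ cb cx] imp_mp]) (simp_all add: cl)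
  have cyz: "?c \<sqsupset> (y \<sqsupset> z) \<in> designated B"
    by (rule imp_trans[OF _ _ _ imp_tmeet[OF _ _ _ ca cx] imp_mp]) (simp_all add: cl)
  have "?c \<sqsupset> z \<in> designated B"
    by (rule imp_trans[OF _ _ _ imp_tmeet[OF _ _ _ cyz cy] imp_mp]) (simp_all add: cl)
  moreover have "?a \<sqsupset> (?b \<sqsupset> (x \<sqsupset> z)) = ?c \<sqsupset> z"
    by (simp add: IB2_t[symmetric] cl)
  ultimately show ?thesis by simp
qed

section \<open>From designated equivalence to equality\<close>

lemma designated_tmeet_iff:
  assumes "x \<in> carrier B" "y \<in> carrier B"
  shows "x \<curlywedge> y \<in> designated B \<longleftrightarrow> x \<in> designated B \<and> y \<in> designated B"
proof
  assume "x \<curlywedge> y \<in> designated B"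
  then show "x \<in> designated B \<and> y \<in> designated B"
    using designated_up_t[OF _ _ t.meet_le_left] designated_up_t[OF _ _ t.meet_le_right] assms
    by blast
next
  assume "x \<in> designated B \<and> y \<in> designated B"
  then show "x \<curlywedge> y \<in> designated B"
    using assms imp_tmeetI[of x y] by (simp add: designated_imp closed)
qed

text \<open>Both inequalities \<open>x \<le>\<^sub>t x \<otimes> y\<close> and \<open>\<sim> x \<le>\<^sub>t \<sim> (x \<otimes> y)\<close> come from IB5, so \<open>x = x \<otimes> y\<close>.\<close>

lemma imp_equiv_eq_kmeet:
  assumes x: "x \<in> carrier B" and y: "y \<in> carrier B"
    and xy: "x \<sqsupset> y \<in> designated B" and nxy: "\<sim> x \<sqsupset> \<sim> y \<in> designated B"
  shows "x = x \<otimes> y"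
proof -
  have "le_t B (\<sim> x) (\<sim> (x \<otimes> y))"
    using imp_le_kmeet[OF _ _ nxy] x y by (simp add: neg_kmeet closed)
  then have "le_t B (x \<otimes> y) x"
    using neg_antimono_t[of "\<sim> x" "\<sim> (x \<otimes> y)"] x y by (simp add: closed neg_neg)
  then show ?thesis
    using t.meet_le_antisym[OF x _ imp_le_kmeet[OF x y xy]] by (simp add: closed x y)
qed

lemma eq_if_imp_equiv:
  assumes x: "x \<in> carrier B" and y: "y \<in> carrier B"
    and "x \<sqsupset> y \<in> designated B" "\<sim> x \<sqsupset> \<sim> y \<in> designated B"
    and "y \<sqsupset> x \<in> designated B" "\<sim> y \<sqsupset> \<sim> x \<in> designated B"
  shows "x = y"
  using imp_equiv_eq_kmeet[of x y] imp_equiv_eq_kmeet[of y x] assms k.meet_comm[of x y] by simp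

end

section \<open>Homomorphisms from the formula algebra\<close>

lemma alg_hom_Fm_iff:
  "v \<in> alg_hom Fm A \<longleftrightarrow> (\<forall>p. v p \<in> carrier A) \<and> (\<forall>p. v (\<^bold>\<not> p) = neg A (v p)) \<and>
    (\<forall>p q. v (p \<^bold>\<and> q) = tmeet A (v p) (v q) \<and> v (p \<^bold>\<or> q) = tjoin A (v p) (v q) \<and>
      v (p \<^bold>\<otimes> q) = kmeet A (v p) (v q) \<and> v (p \<^bold>\<oplus> q) = kjoin A (v p) (v q) \<and>
      v (p \<^bold>\<supset> q) = imp A (v p) (v q))"
  by (simp add: alg_hom_def Fm_def)

text \<open>The homomorphic extension of an assignment; it realises arbitrary elements as values of
  variables, so that valid equations become identities on the carrier.\<close>

primrec eval :: "'a impbilat \<Rightarrow> (nat \<Rightarrow> 'a) \<Rightarrow> fm \<Rightarrow> 'a" where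
  "eval A s (Var n) = s n"
| "eval A s (p \<^bold>\<and> q) = tmeet A (eval A s p) (eval A s q)"
| "eval A s (p \<^bold>\<or> q) = tjoin A (eval A s p) (eval A s q)"
| "eval A s (p \<^bold>\<otimes> q) = kmeet A (eval A s p) (eval A s q)"
| "eval A s (p \<^bold>\<oplus> q) = kjoin A (eval A s p) (eval A s q)"
| "eval A s (p \<^bold>\<supset> q) = imp A (eval A s p) (eval A s q)"
| "eval A s (\<^bold>\<not> p) = neg A (eval A s p)"

lemma eval_hom:
  assumes "is_algebra A" "\<And>n. s n \<in> carrier A"
  shows "eval A s \<in> alg_hom Fm A"
proof -
  have "eval A s p \<in> carrier A" for p
    using assms by (induction p) (auto simp: is_algebra_def)
  then show ?thesis by (simp add: alg_hom_Fm_iff)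
qed

section \<open>An equational basis for implicative bilattices\<close>

definition lattice_eqs :: "(fm \<Rightarrow> fm \<Rightarrow> fm) \<Rightarrow> (fm \<Rightarrow> fm \<Rightarrow> fm) \<Rightarrow> (fm \<times> fm) set"
  where "lattice_eqs m j = (let x = Var 0; y = Var 1; z = Var 2 in
   {(m (m x y) z, m x (m y z)), (j (j x y) z, j x (j y z)),
    (m x y, m y x), (j x y, j y x), (m x (j x y), x), (j x (m x y), x)})"

text \<open>The monotonicity conditions on negation are implications, not equations. Two De Morgan
  identities replace them, and the double equations IB2 and IB4 are split.\<close>

definition impbilat_eqs :: "(fm \<times> fm) set"
  where "impbilat_eqs = lattice_eqs And Or \<union> lattice_eqs Otimes Oplus \<union>
   (let x = Var 0; y = Var 1; z = Var 2 in
   {(\<^bold>\<not> (x \<^bold>\<and> y), \<^bold>\<not> x \<^bold>\<or> \<^bold>\<not> y), (\<^bold>\<not> (x \<^bold>\<otimes> y), \<^bold>\<not> x \<^bold>\<otimes> \<^bold>\<not> y), (\<^bold>\<not> (\<^bold>\<not> x), x),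
    ((x \<^bold>\<supset> x) \<^bold>\<supset> y, y),
    (x \<^bold>\<supset> (y \<^bold>\<supset> z), (x \<^bold>\<and> y) \<^bold>\<supset> z), ((x \<^bold>\<and> y) \<^bold>\<supset> z, (x \<^bold>\<otimes> y) \<^bold>\<supset> z),
    (((x \<^bold>\<supset> y) \<^bold>\<supset> x) \<^bold>\<supset> x, x \<^bold>\<supset> x),
    ((x \<^bold>\<or> y) \<^bold>\<supset> z, (x \<^bold>\<supset> z) \<^bold>\<and> (y \<^bold>\<supset> z)), ((x \<^bold>\<supset> z) \<^bold>\<and> (y \<^bold>\<supset> z), (x \<^bold>\<oplus> y) \<^bold>\<supset> z),
    (x \<^bold>\<and> ((x \<^bold>\<supset> y) \<^bold>\<supset> (x \<^bold>\<otimes> y)), x),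
    (\<^bold>\<not> (x \<^bold>\<supset> y) \<^bold>\<supset> z, (x \<^bold>\<and> \<^bold>\<not> y) \<^bold>\<supset> z)})"

lemma implicative_bilattice_satisfies:
  assumes "implicative_bilattice A" "e \<in> impbilat_eqs" "v \<in> alg_hom Fm A"
  shows "satisfies v e"
proof -
  interpret implicative_bilattice A by fact
  show ?thesis
    using assms(2,3)
    apply (simp add: impbilat_eqs_def lattice_eqs_def Let_def alg_hom_Fm_iff)
    apply (elim disjE)
    by (simp_all add: satisfies_def t.meet_assoc t.join_assoc k.meet_assoc k.join_assoc
      t.meet_absorb t.join_absorb k.meet_absorb k.join_absorb neg_tmeet neg_kmeet neg_neg
      IB1 IB2_t IB2_k IB3 IB4_t IB4_k IB5 IB6 closed,
      simp_all add: t.meet_comm t.join_comm k.meet_comm k.join_comm)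
qed

lemma implicative_bilattice_if_satisfies:
  assumes alg: "is_algebra A"
    and sat: "\<And>e v. \<lbrakk>e \<in> impbilat_eqs; v \<in> alg_hom Fm A\<rbrakk> \<Longrightarrow> satisfies v e"
  shows "implicative_bilattice A"
proof -
  have *: "\<forall>e \<in> impbilat_eqs. eval A (\<lambda>n. if n = 0 then x else if n = 1 then y else z) (fst e) =
      eval A (\<lambda>n. if n = 0 then x else if n = 1 then y else z) (snd e)"
    if "x \<in> carrier A" "y \<in> carrier A" "z \<in> carrier A" for x y z
    using sat[OF _ eval_hom[OF alg]] that by (simp add: satisfies_def)
  note eqs = *[unfolded impbilat_eqs_def lattice_eqs_def Let_def, simplified ball_Un, simplified]
  have cl: "tmeet A x y \<in> carrier A" "tjoin A x y \<in> carrier A" "kmeet A x y \<in> carrier A"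
    "kjoin A x y \<in> carrier A" "imp A x y \<in> carrier A" "neg A x \<in> carrier A"
    if "x \<in> carrier A" "y \<in> carrier A" for x y
    using alg that by (auto simp: is_algebra_def)
  have eqs2:
    "tmeet A x y = tmeet A y x"
    "tjoin A x y = tjoin A y x"
    "kmeet A x y = kmeet A y x"
    "kjoin A x y = kjoin A y x"
    "tmeet A x (tjoin A x y) = x"
    "tjoin A x (tmeet A x y) = x"
    "kmeet A x (kjoin A x y) = x"
    "kjoin A x (kmeet A x y) = x"
    "neg A (tmeet A x y) = tjoin A (neg A x) (neg A y)"
    "neg A (kmeet A x y) = kmeet A (neg A x) (neg A y)"
    "neg A (neg A x) = x"
    "imp A (imp A x x) y = y"
    "imp A (imp A (imp A x y) x) x = imp A x x"
    "tmeet A x (imp A (imp A x y) (kmeet A x y)) = x"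
    if "x \<in> carrier A" "y \<in> carrier A" for x y
    \<comment> \<open>These equations contain only the first two variables, so the third is given
      the value \<open>x\<close>.\<close>
    using eqs[OF that(1,2,1)] by - (elim conjE, assumption)+
  have eqs3:
    "tmeet A (tmeet A x y) z = tmeet A x (tmeet A y z)"
    "tjoin A (tjoin A x y) z = tjoin A x (tjoin A y z)"
    "kmeet A (kmeet A x y) z = kmeet A x (kmeet A y z)"
    "kjoin A (kjoin A x y) z = kjoin A x (kjoin A y z)"
    "imp A x (imp A y z) = imp A (tmeet A x y) z"
    "imp A (tmeet A x y) z = imp A (kmeet A x y) z"
    "imp A (tjoin A x y) z = tmeet A (imp A x z) (imp A y z)"
    "tmeet A (imp A x z) (imp A y z) = imp A (kjoin A x y) z"
    "imp A (neg A (imp A x y)) z = imp A (tmeet A x (neg A y)) z"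
    if "x \<in> carrier A" "y \<in> carrier A" "z \<in> carrier A" for x y z
    using eqs[OF that] by - (elim conjE, assumption)+
  have t: "lattice_on (carrier A) (tmeet A) (tjoin A)"
    by unfold_locales (rule cl eqs2 eqs3; assumption)+
  have k: "lattice_on (carrier A) (kmeet A) (kjoin A)"
    by unfold_locales (rule cl eqs2 eqs3; assumption)+
  have neg: "neg A (tmeet A x y) = tjoin A (neg A x) (neg A y)"
    "neg A (kmeet A x y) = kmeet A (neg A x) (neg A y)" "neg A (neg A x) = x"
    if "x \<in> carrier A" "y \<in> carrier A" for x y
    using that by (rule eqs2)+
  interpret t: lattice_on "carrier A" "tmeet A" "tjoin A" by (rule t)
  interpret k: lattice_on "carrier A" "kmeet A" "kjoin A" by (rule k)
  have "bilattice A"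
  proof
    show "carrier A \<noteq> {}" using alg by (simp add: is_algebra_def)
  next
    fix x y assume "x \<in> carrier A" "y \<in> carrier A" "le_t A x y"
    \<comment> \<open>As \<open>x\<close> is the meet of \<open>x\<close> and \<open>y\<close>, its
      negation is the join of both negations, hence above that of \<open>y\<close>.\<close>
    then show "le_t A (neg A y) (neg A x)"
      using neg(1)[of x y] cl t.join_ge_right by (metis meet_le_def)
  next
    fix x y assume "x \<in> carrier A" "y \<in> carrier A" "le_k A x y"
    then show "le_k A (neg A x) (neg A y)"
      using neg(2)[of x y] by (simp add: meet_le_def)
  qed (rule t k | (rule cl neg; assumption))+
  moreover have "implicative_bilattice_axioms A"
    by unfold_locales (rule cl eqs2 eqs3; assumption)+
  ultimately show ?thesis by (simp add: implicative_bilattice_def)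
qed

lemma variety_ImpBiLat: "variety (ImpBiLat :: 'a impbilat set)"
proof -
  have "is_algebra A" if "implicative_bilattice A" for A :: "'a impbilat"
  proof -
    interpret implicative_bilattice A by (rule that)
    show ?thesis by (simp add: is_algebra_def nonempty closed)
  qed
  then have "implicative_bilattice A \<longleftrightarrow>
      is_algebra A \<and> (\<forall>e \<in> impbilat_eqs. \<forall>v \<in> alg_hom Fm A. satisfies v e)"
    for A :: "'a impbilat"
    by (metis implicative_bilattice_satisfies implicative_bilattice_if_satisfies)
  then show ?thesis
    unfolding variety_def ImpBiLat_def by (intro exI[of _ impbilat_eqs] Collect_cong)
qed

section \<open>Bivaluations\<close>

text \<open>
  A homomorphism into the four-element bilattice is determined by the set of formulas with
  designated value: writing the truth values as pairs of booleans, \<open>\<phi>\<close> has the value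
  \<open>(\<phi> \<in> P, \<^bold>\<not> \<phi> \<in> P)\<close>.
\<close>

definition bivaluation :: "fm set \<Rightarrow> bool"
  where "bivaluation P \<longleftrightarrow> (\<forall>p q.
    (p \<^bold>\<and> q \<in> P \<longleftrightarrow> p \<in> P \<and> q \<in> P) \<and> (p \<^bold>\<or> q \<in> P \<longleftrightarrow> p \<in> P \<or> q \<in> P) \<and>
    (p \<^bold>\<otimes> q \<in> P \<longleftrightarrow> p \<in> P \<and> q \<in> P) \<and> (p \<^bold>\<oplus> q \<in> P \<longleftrightarrow> p \<in> P \<or> q \<in> P) \<and>
    (p \<^bold>\<supset> q \<in> P \<longleftrightarrow> (p \<in> P \<longrightarrow> q \<in> P)) \<and>
    (\<^bold>\<not> (p \<^bold>\<and> q) \<in> P \<longleftrightarrow> \<^bold>\<not> p \<in> P \<or> \<^bold>\<not> q \<in> P) \<and>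
    (\<^bold>\<not> (p \<^bold>\<or> q) \<in> P \<longleftrightarrow> \<^bold>\<not> p \<in> P \<and> \<^bold>\<not> q \<in> P) \<and>
    (\<^bold>\<not> (p \<^bold>\<otimes> q) \<in> P \<longleftrightarrow> \<^bold>\<not> p \<in> P \<and> \<^bold>\<not> q \<in> P) \<and>
    (\<^bold>\<not> (p \<^bold>\<oplus> q) \<in> P \<longleftrightarrow> \<^bold>\<not> p \<in> P \<or> \<^bold>\<not> q \<in> P) \<and>
    (\<^bold>\<not> (p \<^bold>\<supset> q) \<in> P \<longleftrightarrow> p \<in> P \<and> \<^bold>\<not> q \<in> P) \<and>
    (\<^bold>\<not> (\<^bold>\<not> p) \<in> P \<longleftrightarrow> p \<in> P))"

text \<open>Primeness for both orders handles the lattice connectives, and the De Morgan laws their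
  negations. For an implication with antecedent outside \<open>F\<close> the value is
  \<open>t\<close>, so the claim needs \<open>t\<close> in \<open>F\<close> and its negation outside
  \<open>F\<close>.\<close>

lemma bivaluation_prime_bifilter:
  assumes "bilattice B" and max: "is_t_max B t" and F: "prime_bifilter B F"
    and v: "v \<in> alg_hom Fm (imp_expansion B F t)"
  shows "bivaluation (v -` F)"
proof -
  interpret bilattice B by fact
  have Ft: "prime_filter_on (carrier B) (tmeet B) (tjoin B) F"
    and Fk: "prime_filter_on (carrier B) (kmeet B) (kjoin B) F"
    using F by (auto simp: prime_bifilter_def)
  have up: "\<lbrakk>a \<in> F; b \<in> carrier B; le_t B a b\<rbrakk> \<Longrightarrow> b \<in> F" for a b
    using Ft by (simp add: prime_filter_on_def)
  have ne: "F \<noteq> {}" and proper: "F \<subset> carrier B"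
    using Ft by (simp_all add: prime_filter_on_def)
  have tB: "t \<in> carrier B" using max by (simp add: is_t_max_def)
  obtain a where a: "a \<in> F" using ne by blast
  then have "le_t B a t" using max proper by (auto simp: is_t_max_def)
  then have tF: "t \<in> F" using up[OF a tB] by blast
  have ntF: "neg B t \<notin> F"
  proof
    assume "neg B t \<in> F"
    \<comment> \<open>The negation of the truth maximum is the truth minimum, so an upward closed
      set containing it is the whole carrier.\<close>
    moreover have "le_t B (neg B t) a" if "a \<in> carrier B" for a
    proof -
      have "le_t B (neg B a) t" using max that neg_closed by (simp add: is_t_max_def)
      then show ?thesis using neg_antimono_t[of "neg B a" t] that tB neg_closed neg_neg by simp
    qed
    ultimately have "carrier B \<subseteq> F" using up by blast
    then show False using proper by blast
  qed
  have vB: "v p \<in> carrier B" for p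
    using v by (simp add: alg_hom_Fm_iff imp_expansion_def)
  have hom: "v (\<^bold>\<not> p) = neg B (v p)" "v (p \<^bold>\<and> q) = tmeet B (v p) (v q)"
    "v (p \<^bold>\<or> q) = tjoin B (v p) (v q)" "v (p \<^bold>\<otimes> q) = kmeet B (v p) (v q)"
    "v (p \<^bold>\<oplus> q) = kjoin B (v p) (v q)" "v (p \<^bold>\<supset> q) = (if v p \<in> F then v q else t)" for p q
    using v by (simp_all add: alg_hom_Fm_iff imp_expansion_def)
  show ?thesis
    using tF ntF vB unfolding bivaluation_def
    by (simp add: hom neg_closed neg_neg neg_tmeet neg_tjoin neg_kmeet neg_kjoin
        t.prime_filter_meet_iff[OF Ft] t.prime_filter_join_iff[OF Ft]
        k.prime_filter_meet_iff[OF Fk] k.prime_filter_join_iff[OF Fk])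
qed

section \<open>The four-element bilattice on a set of four elements of a given type\<close>

text \<open>The pairs \<open>(True, False)\<close>, \<open>(False, True)\<close>,
  \<open>(True, True)\<close>, \<open>(False, False)\<close> code t, f, \<top>, \<bottom>. The truth
  order reverses the second coordinate, the knowledge order neither. The map \<open>i\<close>
  transports the algebra into the given type.\<close>

definition four :: "(bool \<times> bool \<Rightarrow> 'a) \<Rightarrow> 'a bilat"
  where "four i = \<lparr>carrier = range i,
    tmeet = (\<lambda>x y. i (fst (inv i x) \<and> fst (inv i y), snd (inv i x) \<or> snd (inv i y))),
    tjoin = (\<lambda>x y. i (fst (inv i x) \<or> fst (inv i y), snd (inv i x) \<and> snd (inv i y))),
    kmeet = (\<lambda>x y. i (fst (inv i x) \<and> fst (inv i y), snd (inv i x) \<and> snd (inv i y))),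
    kjoin = (\<lambda>x y. i (fst (inv i x) \<or> fst (inv i y), snd (inv i x) \<or> snd (inv i y))),
    neg = (\<lambda>x. i (snd (inv i x), fst (inv i x)))\<rparr>"

definition four_filter :: "(bool \<times> bool \<Rightarrow> 'a) \<Rightarrow> 'a set"
  where "four_filter i = i ` {a. fst a}"

definition four_imp :: "(bool \<times> bool \<Rightarrow> 'a) \<Rightarrow> 'a impbilat"
  where "four_imp i = imp_expansion (four i) (four_filter i) (i (True, False))"

lemma ex_inj_four:
  assumes "infinite (UNIV :: 'a set)"
  shows "\<exists>i :: bool \<times> bool \<Rightarrow> 'a. inj i"
proof -
  obtain S :: "'a set" where S: "finite S" "card S = card (UNIV :: (bool \<times> bool) set)"
    using infinite_arbitrarily_large[OF assms] by blast
  then obtain i where "bij_betw i (UNIV :: (bool \<times> bool) set) S"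
    using finite_same_card_bij[OF finite_UNIV S(1)] by metis
  then show ?thesis using bij_betw_imp_inj_on by blast
qed

context
  fixes i :: "bool \<times> bool \<Rightarrow> 'a"
  assumes inj: "inj i"
begin

lemma four_ops:
  "carrier (four i) = range i"
  "tmeet (four i) (i (a, b)) (i (c, d)) = i (a \<and> c, b \<or> d)"
  "tjoin (four i) (i (a, b)) (i (c, d)) = i (a \<or> c, b \<and> d)"
  "kmeet (four i) (i (a, b)) (i (c, d)) = i (a \<and> c, b \<and> d)"
  "kjoin (four i) (i (a, b)) (i (c, d)) = i (a \<or> c, b \<or> d)"
  "neg (four i) (i (a, b)) = i (b, a)"
  by (simp_all add: four_def inv_f_f[OF inj])

lemma four_filter_iff: "i (a, b) \<in> four_filter i \<longleftrightarrow> a"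
  by (auto simp: four_filter_def inj_eq[OF inj])

lemma bilattice_four: "bilattice (four i)"
  by unfold_locales (auto simp: four_ops meet_le_def inj_eq[OF inj])

lemma is_t_max_four: "is_t_max (four i) (i (True, False))"
  by (auto simp: is_t_max_def four_ops meet_le_def inj_eq[OF inj])

lemma prime_bifilter_four: "prime_bifilter (four i) (four_filter i)"
proof -
  have "four_filter i \<subset> range i"
    using four_filter_iff[of False False] by (auto simp: four_filter_def)
  moreover have "four_filter i \<noteq> {}"
    using four_filter_iff[of True False] by auto
  \<comment> \<open>Serves below as a destruction rule: it writes filter elements as pairs, on which
    \<open>four_ops\<close> computes.\<close>
  moreover have "x \<in> four_filter i \<Longrightarrow> \<exists>b. x = i (True, b)" for x
    by (auto simp: four_filter_def)
  ultimately show ?thesis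
    unfolding prime_bifilter_def prime_filter_on_def four_ops(1)
    by (auto simp: four_ops meet_le_def inj_eq[OF inj] four_filter_iff dest!: \<open>\<And>x. x \<in> _ \<Longrightarrow> _\<close>)
qed

lemma four_imp_ops:
  "carrier (four_imp i) = range i"
  "tmeet (four_imp i) = tmeet (four i)" "tjoin (four_imp i) = tjoin (four i)"
  "kmeet (four_imp i) = kmeet (four i)" "kjoin (four_imp i) = kjoin (four i)"
  "neg (four_imp i) = neg (four i)"
  "imp (four_imp i) (i (a, b)) (i (c, d)) = i (a \<longrightarrow> c, a \<and> d)"
  by (simp_all add: four_imp_def imp_expansion_def four_ops four_filter_iff)

lemma implicative_bilattice_four_imp: "implicative_bilattice (four_imp i)"
  by unfold_locales (auto simp: four_imp_ops four_ops meet_le_def inj_eq[OF inj])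

lemma hom_four_imp:
  assumes "bivaluation P"
  shows "(\<lambda>p. i (p \<in> P, \<^bold>\<not> p \<in> P)) \<in> alg_hom Fm (four_imp i)"
  using assms by (auto simp: alg_hom_Fm_iff four_imp_ops four_ops bivaluation_def inj_eq[OF inj])

end

section \<open>Bivaluation semantics of the logic\<close>

lemma LB_consequence_iff_bivaluation:
  assumes "infinite (UNIV :: 'b set)"
  shows "LB_consequence TYPE('b) \<Gamma> \<phi> \<longleftrightarrow> (\<forall>P. bivaluation P \<longrightarrow> \<Gamma> \<subseteq> P \<longrightarrow> \<phi> \<in> P)"
proof
  assume L: "LB_consequence TYPE('b) \<Gamma> \<phi>"
  obtain i :: "bool \<times> bool \<Rightarrow> 'b" where i: "inj i" using ex_inj_four[OF assms] by blast
  show "\<forall>P. bivaluation P \<longrightarrow> \<Gamma> \<subseteq> P \<longrightarrow> \<phi> \<in> P"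
  proof (intro allI impI)
    fix P assume P: "bivaluation P" "\<Gamma> \<subseteq> P"
    let ?v = "\<lambda>p. i (p \<in> P, \<^bold>\<not> p \<in> P)"
    have "?v \<in> alg_hom Fm (imp_expansion (four i) (four_filter i) (i (True, False)))"
      using hom_four_imp[OF i P(1)] by (simp add: four_imp_def)
    moreover have "?v ` \<Gamma> \<subseteq> four_filter i"
      using P(2) by (auto simp: four_filter_iff[OF i])
    ultimately have "?v \<phi> \<in> four_filter i"
      using L bilattice_four[OF i] is_t_max_four[OF i] prime_bifilter_four[OF i]
      unfolding LB_consequence_def by blast
    then show "\<phi> \<in> P" by (simp add: four_filter_iff[OF i])
  qed
next
  assume "\<forall>P. bivaluation P \<longrightarrow> \<Gamma> \<subseteq> P \<longrightarrow> \<phi> \<in> P"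
  then show "LB_consequence TYPE('b) \<Gamma> \<phi>"
    unfolding LB_consequence_def
    using bivaluation_prime_bifilter by (metis image_subset_iff_subset_vimage vimage_eq)
qed

section \<open>Theories and their maximal extensions\<close>

text \<open>
  The hypotheses are the axioms and the rule of the Hilbert calculus, except that the
  axioms for \<open>\<or>\<close> and \<open>\<oplus>\<close> are given in the form of IB4.
\<close>

locale lb_theory =
  fixes T :: "fm set"
  assumes mp: "\<lbrakk>p \<^bold>\<supset> q \<in> T; p \<in> T\<rbrakk> \<Longrightarrow> q \<in> T"
    and K: "p \<^bold>\<supset> (q \<^bold>\<supset> p) \<in> T"
    and S: "(p \<^bold>\<supset> (q \<^bold>\<supset> r)) \<^bold>\<supset> ((p \<^bold>\<supset> q) \<^bold>\<supset> (p \<^bold>\<supset> r)) \<in> T"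
    and Peirce: "((p \<^bold>\<supset> q) \<^bold>\<supset> p) \<^bold>\<supset> p \<in> T"
    and andE: "p \<^bold>\<and> q \<^bold>\<supset> p \<in> T" "p \<^bold>\<and> q \<^bold>\<supset> q \<in> T"
    and andI: "p \<^bold>\<supset> (q \<^bold>\<supset> p \<^bold>\<and> q) \<in> T"
    and otimesE: "p \<^bold>\<otimes> q \<^bold>\<supset> p \<in> T" "p \<^bold>\<otimes> q \<^bold>\<supset> q \<in> T"
    and otimesI: "p \<^bold>\<supset> (q \<^bold>\<supset> p \<^bold>\<otimes> q) \<in> T"
    and orI: "p \<^bold>\<supset> p \<^bold>\<or> q \<in> T" "q \<^bold>\<supset> p \<^bold>\<or> q \<in> T"
    and orE: "(p \<^bold>\<supset> r) \<^bold>\<and> (q \<^bold>\<supset> r) \<^bold>\<supset> (p \<^bold>\<or> q \<^bold>\<supset> r) \<in> T"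
    and oplusI: "p \<^bold>\<supset> p \<^bold>\<oplus> q \<in> T" "q \<^bold>\<supset> p \<^bold>\<oplus> q \<in> T"
    and oplusE: "(p \<^bold>\<supset> r) \<^bold>\<and> (q \<^bold>\<supset> r) \<^bold>\<supset> (p \<^bold>\<oplus> q \<^bold>\<supset> r) \<in> T"
    and neg_and: "\<^bold>\<not> (p \<^bold>\<and> q) \<^bold>\<supset> \<^bold>\<not> p \<^bold>\<or> \<^bold>\<not> q \<in> T" "\<^bold>\<not> p \<^bold>\<or> \<^bold>\<not> q \<^bold>\<supset> \<^bold>\<not> (p \<^bold>\<and> q) \<in> T"
    and neg_or: "\<^bold>\<not> (p \<^bold>\<or> q) \<^bold>\<supset> \<^bold>\<not> p \<^bold>\<and> \<^bold>\<not> q \<in> T" "\<^bold>\<not> p \<^bold>\<and> \<^bold>\<not> q \<^bold>\<supset> \<^bold>\<not> (p \<^bold>\<or> q) \<in> T"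
    and neg_otimes:
      "\<^bold>\<not> (p \<^bold>\<otimes> q) \<^bold>\<supset> \<^bold>\<not> p \<^bold>\<otimes> \<^bold>\<not> q \<in> T" "\<^bold>\<not> p \<^bold>\<otimes> \<^bold>\<not> q \<^bold>\<supset> \<^bold>\<not> (p \<^bold>\<otimes> q) \<in> T"
    and neg_oplus:
      "\<^bold>\<not> (p \<^bold>\<oplus> q) \<^bold>\<supset> \<^bold>\<not> p \<^bold>\<oplus> \<^bold>\<not> q \<in> T" "\<^bold>\<not> p \<^bold>\<oplus> \<^bold>\<not> q \<^bold>\<supset> \<^bold>\<not> (p \<^bold>\<oplus> q) \<in> T"
    and neg_imp: "\<^bold>\<not> (p \<^bold>\<supset> q) \<^bold>\<supset> p \<^bold>\<and> \<^bold>\<not> q \<in> T" "p \<^bold>\<and> \<^bold>\<not> q \<^bold>\<supset> \<^bold>\<not> (p \<^bold>\<supset> q) \<in> T"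
    and neg_neg: "\<^bold>\<not> (\<^bold>\<not> p) \<^bold>\<supset> p \<in> T" "p \<^bold>\<supset> \<^bold>\<not> (\<^bold>\<not> p) \<in> T"

text \<open>Axioms are membership statements and survive enlargement of \<open>T\<close>; only
  closure under modus ponens has to be checked again.\<close>

lemma lb_theory_extend:
  assumes "lb_theory T" "T \<subseteq> T'" "\<And>p q. \<lbrakk>p \<^bold>\<supset> q \<in> T'; p \<in> T'\<rbrakk> \<Longrightarrow> q \<in> T'"
  shows "lb_theory T'"
  using assms unfolding lb_theory_def subset_iff by meson

context lb_theory
begin

lemma imp_weaken: "q \<in> T \<Longrightarrow> p \<^bold>\<supset> q \<in> T"
  using K mp by blast

lemma imp_refl: "p \<^bold>\<supset> p \<in> T"
  using S[of p "p \<^bold>\<supset> p" p] K mp by blast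

lemma imp_mp: "\<lbrakk>a \<^bold>\<supset> (p \<^bold>\<supset> q) \<in> T; a \<^bold>\<supset> p \<in> T\<rbrakk> \<Longrightarrow> a \<^bold>\<supset> q \<in> T"
  using S mp by blast

text \<open>The deduction theorem in semantic form: this set is the least theory containing
  \<open>T\<close> and \<open>a\<close>. K gives the inclusion of \<open>T\<close>, and S gives
  closure under modus ponens.\<close>

lemma lb_theory_adjoin: "lb_theory {p. a \<^bold>\<supset> p \<in> T}"
proof (rule lb_theory_extend[OF lb_theory_axioms])
  show "T \<subseteq> {p. a \<^bold>\<supset> p \<in> T}" using imp_weaken by blast
  fix p q assume "p \<^bold>\<supset> q \<in> {p. a \<^bold>\<supset> p \<in> T}" "p \<in> {p. a \<^bold>\<supset> p \<in> T}"
  then show "q \<in> {p. a \<^bold>\<supset> p \<in> T}" using imp_mp[of a p q] by simp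
qed

text \<open>Classical case distinction from Peirce's law: under the hypothesis \<open>?h\<close>,
  \<open>a\<close> yields \<open>c\<close> and hence \<open>b\<close>, so \<open>c\<close> follows
  by the first assumption. Thus \<open>?h\<close> implies \<open>c\<close>, and Peirce's law removes
  \<open>?h\<close>.\<close>

lemma imp_cases:
  assumes 1: "(a \<^bold>\<supset> b) \<^bold>\<supset> c \<in> T" and 2: "a \<^bold>\<supset> c \<in> T"
  shows "c \<in> T"
proof -
  let ?h = "c \<^bold>\<supset> b"
  interpret T': lb_theory "{p. ?h \<^bold>\<supset> p \<in> T}" by (rule lb_theory_adjoin)
  have "?h \<^bold>\<supset> (a \<^bold>\<supset> c) \<in> T" using imp_weaken[OF 2] .
  moreover have "?h \<^bold>\<supset> (a \<^bold>\<supset> (c \<^bold>\<supset> b)) \<in> T" by (rule K)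
  ultimately have "?h \<^bold>\<supset> (a \<^bold>\<supset> b) \<in> T" using T'.imp_mp[of a c b] by simp
  then have "?h \<^bold>\<supset> c \<in> T" using imp_mp[OF imp_weaken[OF 1]] by blast
  then show ?thesis using mp[OF Peirce] by blast
qed

text \<open>The assumption \<open>imp\<close> makes implication material with respect to membership
  in \<open>T\<close>, after which every axiom reads as a truth-functional condition.\<close>

lemma bivaluation_if_imp:
  assumes imp: "\<And>p q. p \<notin> T \<Longrightarrow> p \<^bold>\<supset> q \<in> T" and c: "c \<notin> T"
  shows "bivaluation T"
proof -
  have I: "p \<^bold>\<supset> q \<in> T \<longleftrightarrow> (p \<in> T \<longrightarrow> q \<in> T)" for p q
    using imp[of p q] mp[of p q] imp_weaken[of q p] by blast
  have A: "p \<^bold>\<and> q \<in> T \<longleftrightarrow> p \<in> T \<and> q \<in> T" for p q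
    using andE[of p q, unfolded I] andI[of p q, unfolded I] by blast
  have M: "p \<^bold>\<otimes> q \<in> T \<longleftrightarrow> p \<in> T \<and> q \<in> T" for p q
    using otimesE[of p q, unfolded I] otimesI[of p q, unfolded I] by blast
  \<comment> \<open>The eliminations are used with conclusion \<open>c\<close>: if neither disjunct
    is in \<open>T\<close>, both imply \<open>c\<close>, so the disjunction cannot be in
    \<open>T\<close>.\<close>
  have O: "p \<^bold>\<or> q \<in> T \<longleftrightarrow> p \<in> T \<or> q \<in> T" for p q
    using orI(1)[of p q, unfolded I] orI(2)[of q p, unfolded I] orE[of p c q, unfolded I A] c
    by blast
  have P: "p \<^bold>\<oplus> q \<in> T \<longleftrightarrow> p \<in> T \<or> q \<in> T" for p q
    using oplusI(1)[of p q, unfolded I] oplusI(2)[of q p, unfolded I] oplusE[of p c q, unfolded I A] c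
    by blast
  have neg: "\<^bold>\<not> (p \<^bold>\<and> q) \<in> T \<longleftrightarrow> \<^bold>\<not> p \<in> T \<or> \<^bold>\<not> q \<in> T"
    "\<^bold>\<not> (p \<^bold>\<or> q) \<in> T \<longleftrightarrow> \<^bold>\<not> p \<in> T \<and> \<^bold>\<not> q \<in> T"
    "\<^bold>\<not> (p \<^bold>\<otimes> q) \<in> T \<longleftrightarrow> \<^bold>\<not> p \<in> T \<and> \<^bold>\<not> q \<in> T"
    "\<^bold>\<not> (p \<^bold>\<oplus> q) \<in> T \<longleftrightarrow> \<^bold>\<not> p \<in> T \<or> \<^bold>\<not> q \<in> T"
    "\<^bold>\<not> (p \<^bold>\<supset> q) \<in> T \<longleftrightarrow> p \<in> T \<and> \<^bold>\<not> q \<in> T"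
    "\<^bold>\<not> (\<^bold>\<not> p) \<in> T \<longleftrightarrow> p \<in> T" for p q
    using neg_and[of p q, unfolded I O] neg_or[of p q, unfolded I A]
      neg_otimes[of p q, unfolded I M] neg_oplus[of p q, unfolded I P]
      neg_imp[of p q, unfolded I A] neg_neg[of p, unfolded I]
    by blast+
  show ?thesis
    unfolding bivaluation_def by (simp only: I A M O P neg simp_thms)
qed

lemma ex_bivaluation:
  assumes c: "c \<notin> T"
  shows "\<exists>P. bivaluation P \<and> T \<subseteq> P \<and> c \<notin> P"
proof -
  let ?\<A> = "{T'. lb_theory T' \<and> T \<subseteq> T' \<and> c \<notin> T'}"
  have "?\<A> \<noteq> {}" using c lb_theory_axioms by blast
  moreover have "\<Union> \<C> \<in> ?\<A>" if ne: "\<C> \<noteq> {}" and ch: "subset.chain ?\<A> \<C>" for \<C>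
  proof -
    have sub: "\<C> \<subseteq> ?\<A>" and lin: "\<forall>X \<in> \<C>. \<forall>Y \<in> \<C>. X \<subseteq> Y \<or> Y \<subseteq> X"
      using ch by (auto simp: subset_chain_def)
    have T: "T \<subseteq> \<Union> \<C>" using ne sub by blast
    have "lb_theory (\<Union> \<C>)"
    proof (rule lb_theory_extend[OF lb_theory_axioms T])
      fix p q assume "p \<^bold>\<supset> q \<in> \<Union> \<C>" "p \<in> \<Union> \<C>"
      \<comment> \<open>Two members of the chain contain these formulas; the larger contains
        both.\<close>
      then obtain X where "X \<in> \<C>" "p \<^bold>\<supset> q \<in> X" "p \<in> X" using lin by blast
      then show "q \<in> \<Union> \<C>" using sub lb_theory.mp[of X p q] by blast
    qed
    then show ?thesis using T sub by blast
  qed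
  ultimately have "\<exists>P \<in> ?\<A>. \<forall>X \<in> ?\<A>. P \<subseteq> X \<longrightarrow> X = P"
    by (rule subset_Zorn_nonempty)
  then obtain P where P: "P \<in> ?\<A>" and max: "\<And>X. \<lbrakk>X \<in> ?\<A>; P \<subseteq> X\<rbrakk> \<Longrightarrow> X = P"
    by (elim bexE) blast
  interpret P: lb_theory P using P by blast
  \<comment> \<open>Otherwise adjoining \<open>p\<close> would still omit \<open>c\<close>, and
    maximality would force \<open>p\<close> into \<open>P\<close>.\<close>
  have imp_c: "p \<^bold>\<supset> c \<in> P" if "p \<notin> P" for p
  proof (rule ccontr)
    assume "p \<^bold>\<supset> c \<notin> P"
    then have "{q. p \<^bold>\<supset> q \<in> P} \<in> ?\<A>"
      using P P.lb_theory_adjoin[of p] P.imp_weaken by blast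
    then have "{q. p \<^bold>\<supset> q \<in> P} = P" using max P.imp_weaken by blast
    then show False using that P.imp_refl[of p] by blast
  qed
  \<comment> \<open>If this implication were also outside \<open>P\<close>, both it and
    \<open>p\<close> would imply \<open>c\<close>, and \<open>imp_cases\<close> would put
    \<open>c\<close> in \<open>P\<close>.\<close>
  have "p \<^bold>\<supset> q \<in> P" if "p \<notin> P" for p q
    using imp_c[OF that] imp_c[of "p \<^bold>\<supset> q"] P.imp_cases[of p q c] P by blast
  moreover have "c \<notin> P" using P by blast
  ultimately have "bivaluation P" by (rule P.bivaluation_if_imp)
  then show ?thesis using P by blast
qed

end

section \<open>Algebraizability\<close>

text \<open>Modus ponens holds because designated elements are left identities. Peirce's law, the
  disjunction eliminations and the negated implication are rewritten by IB3, IB4 and IB6 to the form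
  \<open>x \<sqsupset> x\<close>.\<close>

lemma lb_theory_designated:
  assumes "implicative_bilattice A" and v: "v \<in> alg_hom Fm A"
  shows "lb_theory (v -` designated A)"
proof -
  interpret implicative_bilattice A by fact
  have vA[simp]: "v p \<in> carrier A" for p using v by (simp add: alg_hom_Fm_iff)
  have hom[simp]: "v (\<^bold>\<not> p) = neg A (v p)" "v (p \<^bold>\<and> q) = tmeet A (v p) (v q)"
    "v (p \<^bold>\<or> q) = tjoin A (v p) (v q)" "v (p \<^bold>\<otimes> q) = kmeet A (v p) (v q)"
    "v (p \<^bold>\<oplus> q) = kjoin A (v p) (v q)" "v (p \<^bold>\<supset> q) = imp A (v p) (v q)" for p q
    using v by (simp_all add: alg_hom_Fm_iff)
  show ?thesis
  proof
    fix p q assume "p \<^bold>\<supset> q \<in> v -` designated A" "p \<in> v -` designated A"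
    then show "q \<in> v -` designated A" by (simp add: designated_imp)
  next
    fix p q r
    show "((p \<^bold>\<supset> q) \<^bold>\<supset> p) \<^bold>\<supset> p \<in> v -` designated A"
      by (simp add: IB3 imp_self)
    show "(p \<^bold>\<supset> r) \<^bold>\<and> (q \<^bold>\<supset> r) \<^bold>\<supset> (p \<^bold>\<or> q \<^bold>\<supset> r) \<in> v -` designated A"
      by (simp add: IB4_t imp_self closed)
    show "(p \<^bold>\<supset> r) \<^bold>\<and> (q \<^bold>\<supset> r) \<^bold>\<supset> (p \<^bold>\<oplus> q \<^bold>\<supset> r) \<in> v -` designated A"
      by (simp add: IB4_k imp_self closed)
    show "\<^bold>\<not> (p \<^bold>\<supset> q) \<^bold>\<supset> p \<^bold>\<and> \<^bold>\<not> q \<in> v -` designated A"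
      by (simp add: IB6 imp_self closed)
    show "p \<^bold>\<and> \<^bold>\<not> q \<^bold>\<supset> \<^bold>\<not> (p \<^bold>\<supset> q) \<in> v -` designated A"
      by (simp add: IB6[symmetric] imp_self closed)
  qed (simp_all add: imp_K imp_S imp_tmeet1 imp_tmeet2 imp_tmeetI imp_kmeetI le_t_imp le_k_imp
      k.meet_le_left k.meet_le_right t.join_ge_left t.join_ge_right k.join_ge_left k.join_ge_right
      neg_tmeet neg_tjoin neg_kmeet neg_kjoin neg_neg imp_self closed)
qed

section \<open>Comparison of the two consequence relations\<close>

lemma satisfies_de_iff:
  assumes "v \<in> alg_hom Fm A"
  shows "satisfies v (p, p \<^bold>\<supset> p) \<longleftrightarrow> v p \<in> designated A"
  using assms by (simp add: satisfies_def designated_def alg_hom_Fm_iff)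

text \<open>Implication of \<open>(a, b)\<close> with itself gives
  \<open>(True, a \<and> b)\<close>, which equals \<open>(a, b)\<close> exactly when
  \<open>a\<close> holds.\<close>

lemma designated_four_imp:
  assumes "inj i"
  shows "i (a, b) \<in> designated (four_imp i) \<longleftrightarrow> a"
  by (auto simp: designated_def four_imp_ops[OF assms] inj_eq[OF assms])

lemma eq_consequence_iff_bivaluation:
  assumes "infinite (UNIV :: 'a set)"
  shows "eq_consequence (ImpBiLat :: 'a impbilat set) ((\<lambda>\<phi>. (\<phi>, \<phi> \<^bold>\<supset> \<phi>)) ` \<Gamma>) (\<phi>, \<phi> \<^bold>\<supset> \<phi>)
    \<longleftrightarrow> (\<forall>P. bivaluation P \<longrightarrow> \<Gamma> \<subseteq> P \<longrightarrow> \<phi> \<in> P)"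
proof
  assume E: "eq_consequence (ImpBiLat :: 'a impbilat set) ((\<lambda>\<phi>. (\<phi>, \<phi> \<^bold>\<supset> \<phi>)) ` \<Gamma>) (\<phi>, \<phi> \<^bold>\<supset> \<phi>)"
  obtain i :: "bool \<times> bool \<Rightarrow> 'a" where i: "inj i" using ex_inj_four[OF assms] by blast
  show "\<forall>P. bivaluation P \<longrightarrow> \<Gamma> \<subseteq> P \<longrightarrow> \<phi> \<in> P"
  proof (intro allI impI)
    fix P assume P: "bivaluation P" "\<Gamma> \<subseteq> P"
    let ?v = "\<lambda>p. i (p \<in> P, \<^bold>\<not> p \<in> P)"
    have v: "?v \<in> alg_hom Fm (four_imp i)" by (rule hom_four_imp[OF i P(1)])
    have "\<forall>d \<in> (\<lambda>\<phi>. (\<phi>, \<phi> \<^bold>\<supset> \<phi>)) ` \<Gamma>. satisfies ?v d"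
      using P(2) by (auto simp: satisfies_de_iff[OF v] designated_four_imp[OF i])
    then have "satisfies ?v (\<phi>, \<phi> \<^bold>\<supset> \<phi>)"
      using E v implicative_bilattice_four_imp[OF i]
      unfolding eq_consequence_def ImpBiLat_def by blast
    then show "\<phi> \<in> P" by (simp add: satisfies_de_iff[OF v] designated_four_imp[OF i])
  qed
next
  assume *: "\<forall>P. bivaluation P \<longrightarrow> \<Gamma> \<subseteq> P \<longrightarrow> \<phi> \<in> P"
  show "eq_consequence (ImpBiLat :: 'a impbilat set) ((\<lambda>\<phi>. (\<phi>, \<phi> \<^bold>\<supset> \<phi>)) ` \<Gamma>) (\<phi>, \<phi> \<^bold>\<supset> \<phi>)"
    unfolding eq_consequence_def ImpBiLat_def
  proof (intro ballI impI)
    fix A :: "'a impbilat" and v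
    assume "A \<in> {B. implicative_bilattice B}" and v: "v \<in> alg_hom Fm A"
      and G: "\<forall>d \<in> (\<lambda>\<phi>. (\<phi>, \<phi> \<^bold>\<supset> \<phi>)) ` \<Gamma>. satisfies v d"
    then interpret T: lb_theory "v -` designated A"
      using lb_theory_designated by blast
    have "\<Gamma> \<subseteq> v -` designated A"
      using G by (auto simp: satisfies_de_iff[OF v])
    \<comment> \<open>Were \<open>\<phi>\<close> missing, \<open>ex_bivaluation\<close> would give a
      bivaluation containing \<open>\<Gamma>\<close> but not \<open>\<phi>\<close>.\<close>
    then have "\<phi> \<in> v -` designated A"
      using T.ex_bivaluation * by blast
    then show "satisfies v (\<phi>, \<phi> \<^bold>\<supset> \<phi>)" by (simp add: satisfies_de_iff[OF v])
  qed
qed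

lemma satisfies_fm_equiv_iff:
  assumes "implicative_bilattice A" and v: "v \<in> alg_hom Fm A"
  shows "satisfies v (p \<^bold>\<leftrightarrow> q, (p \<^bold>\<leftrightarrow> q) \<^bold>\<supset> (p \<^bold>\<leftrightarrow> q)) \<longleftrightarrow> v p = v q"
proof -
  interpret implicative_bilattice A by fact
  have vA: "v p \<in> carrier A" for p using v by (simp add: alg_hom_Fm_iff)
  have hom: "v (\<^bold>\<not> p) = neg A (v p)" "v (p \<^bold>\<and> q) = tmeet A (v p) (v q)"
    "v (p \<^bold>\<supset> q) = imp A (v p) (v q)" for p q
    using v by (simp_all add: alg_hom_Fm_iff)
  show ?thesis
    unfolding satisfies_de_iff[OF v]
    using eq_if_imp_equiv[OF vA vA, of p q]
    by (auto simp: fm_equiv_def fm_to_def hom vA closed designated_tmeet_iff imp_self)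
qed

theorem theorem4p3p10:
  assumes "infinite (UNIV :: 'a set)" and "infinite (UNIV :: 'b set)"
  shows "algebraizable (LB_consequence TYPE('b)) (ImpBiLat :: 'a impbilat set)
    (\<lambda>\<phi> \<psi>. \<phi> \<^bold>\<leftrightarrow> \<psi>) (\<lambda>\<phi>. (\<phi>, \<phi> \<^bold>\<supset> \<phi>))"
  unfolding algebraizable_def
proof (intro conjI allI)
  show "variety (ImpBiLat :: 'a impbilat set)" by (rule variety_ImpBiLat)
next
  fix \<Gamma> \<phi>
  show "LB_consequence TYPE('b) \<Gamma> \<phi> \<longleftrightarrow>
      eq_consequence (ImpBiLat :: 'a impbilat set) ((\<lambda>\<phi>. (\<phi>, \<phi> \<^bold>\<supset> \<phi>)) ` \<Gamma>) (\<phi>, \<phi> \<^bold>\<supset> \<phi>)"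
    \<comment> \<open>Both sides reduce to preservation under bivaluations, a condition that
      mentions neither carrier type.\<close>
    using LB_consequence_iff_bivaluation[OF assms(2)] eq_consequence_iff_bivaluation[OF assms(1)]
    by simp
next
  fix \<phi> \<psi>
  show "eq_consequence (ImpBiLat :: 'a impbilat set) {(\<phi>, \<psi>)} (\<phi> \<^bold>\<leftrightarrow> \<psi>, (\<phi> \<^bold>\<leftrightarrow> \<psi>) \<^bold>\<supset> (\<phi> \<^bold>\<leftrightarrow> \<psi>))"
    and "eq_consequence (ImpBiLat :: 'a impbilat set) {(\<phi> \<^bold>\<leftrightarrow> \<psi>, (\<phi> \<^bold>\<leftrightarrow> \<psi>) \<^bold>\<supset> (\<phi> \<^bold>\<leftrightarrow> \<psi>))} (\<phi>, \<psi>)"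
    unfolding eq_consequence_def ImpBiLat_def
    by (auto simp: satisfies_fm_equiv_iff, simp_all add: satisfies_def)
qed

end
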